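(* Let $\mathcal{X}\subseteq\mathbb{R}^n\times\mathbb{R}^{m\times n}\times\mathbb{R}^m$ be a domain of LP problems. Suppose that there is an $m\times n$ matrix $A$ and a vector $p\in\mathbb{R}^n$ such that for all $\xi\in\mathcal{X}$, $A(\xi)=A$ and $p(\xi)=p$. Then the optimal value function $V$ is continuous on $\mathcal{X}$.
   Context: Let $m,n$ be positive integers. An $m\times n$ LP problem is a triple $\xi=(p(\xi),A(\xi),b(\xi))\in\mathbb{R}^n\times\mathbb{R}^{m\times n}\times\mathbb{R}^m$, standing for: maximize $p(\xi)^Tx$ subject to $A(\xi)x=b(\xi)$, $x\ge 0$ (coordinatewise). Its feasible set is $X(\xi)=\{x\in\mathbb{R}^n_+ : A(\xi)x=b(\xi)\}$ and its set of optimal solutions is $S(\xi)=\{x\in X(\xi): p(\xi)^Tx\ge p(\xi)^Tx' \text{ for all } x'\in X(\xi)\}$. A domain is a non-empty subset $\mathcal{X}$ of $\mathbb{R}^n\times\mathbb{R}^{m\times n}\times\mathbb{R}^m$ such that $S(\xi)\neq\emptyset$ for every $\xi\in\mathcal{X}$. The optimal value function $V:\mathcal{X}\to\mathbb{R}$ is $V(\xi)=p(\xi)^Tx$ for any $x\in S(\xi)$. Convergence of LP problems means convergence of each component $p$, $A$, $b$ in Euclidean norm; continuity of $V$ is with respect to this convergence within $\mathcal{X}$. *)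

theory Defs
  imports "HOL-Analysis.Analysis"
begin

(* Index types 'm and 'n are nonempty, so m, n \<ge> 1 is automatic. The product and vector
   topologies make convergence of problems the Euclidean convergence of each of p, A, b. *)
type_synonym ('m, 'n) lp = "(real ^ 'n) \<times> (real ^ 'n ^ 'm) \<times> (real ^ 'm)"

definition lp_p :: "('m::finite, 'n::finite) lp \<Rightarrow> real ^ 'n"
  where "lp_p \<xi> = fst \<xi>"

definition lp_A :: "('m::finite, 'n::finite) lp \<Rightarrow> real ^ 'n ^ 'm"
  where "lp_A \<xi> = fst (snd \<xi>)"

definition lp_b :: "('m::finite, 'n::finite) lp \<Rightarrow> real ^ 'm"
  where "lp_b \<xi> = snd (snd \<xi>)"

definition feasible_set :: "('m::finite, 'n::finite) lp \<Rightarrow> (real ^ 'n) set"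
  where "feasible_set \<xi> = {x. (\<forall>j. 0 \<le> x $ j) \<and> lp_A \<xi> *v x = lp_b \<xi>}"

definition optimal_set :: "('m::finite, 'n::finite) lp \<Rightarrow> (real ^ 'n) set"
  where "optimal_set \<xi> =
    {x \<in> feasible_set \<xi>. \<forall>x' \<in> feasible_set \<xi>. lp_p \<xi> \<bullet> x' \<le> lp_p \<xi> \<bullet> x}"

definition lp_domain :: "('m::finite, 'n::finite) lp set \<Rightarrow> bool"
  where "lp_domain X \<longleftrightarrow> X \<noteq> {} \<and> (\<forall>\<xi> \<in> X. optimal_set \<xi> \<noteq> {})"

(* Meaningful only when optimal_set is nonempty; see optimal_value_eq. *)
definition optimal_value :: "('m::finite, 'n::finite) lp \<Rightarrow> real"
  where "optimal_value \<xi> = (THE v. \<exists>x \<in> optimal_set \<xi>. v = lp_p \<xi> \<bullet> x)"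

lemma optimal_value_eq:
  assumes "x \<in> optimal_set \<xi>"
  shows "optimal_value \<xi> = lp_p \<xi> \<bullet> x"
  unfolding optimal_value_def
proof (rule the_equality)
  show "\<exists>y \<in> optimal_set \<xi>. lp_p \<xi> \<bullet> x = lp_p \<xi> \<bullet> y"
    using assms by blast
next
  fix v assume "\<exists>y \<in> optimal_set \<xi>. v = lp_p \<xi> \<bullet> y"
  then show "v = lp_p \<xi> \<bullet> x"
    using assms by (auto simp: optimal_set_def intro: order_antisym)
qed

end

theory Submission
  imports Defs
begin

text \<open>
  Moving from a point \<open>x \<ge> 0\<close> to the nearest point \<open>y\<close> of a polyhedron
  \<open>{y \<ge> 0. A y = b}\<close>, no nonzero kernel vector of \<open>A\<close> agrees in sign with \<open>y - x\<close> on its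
  support, for otherwise \<open>y\<close> could be shifted along it towards \<open>x\<close>. By compactness of the
  unit sphere, \<open>norm (A d)\<close> is bounded below by a multiple of \<open>norm d\<close> over all such
  differences \<open>d\<close>. This gives a Hoffman bound with a constant depending on \<open>A\<close> only, hence the
  optimal value is Lipschitz in the right-hand side \<open>b\<close>.
\<close>

text \<open>The strict inequality on the support of \<open>k\<close> makes the condition open in
  \<open>d\<close> for fixed \<open>k\<close>, and every vector conformal to itself.\<close>

definition conformal :: "real ^ 'n \<Rightarrow> real ^ 'n \<Rightarrow> bool"
  where "conformal k d \<longleftrightarrow> (\<forall>j. k $ j \<noteq> 0 \<longrightarrow> 0 < k $ j * d $ j)"

text \<open>A cone depending on \<open>A\<close> alone that contains every difference a projection
  onto such a polyhedron can produce; this is why one constant serves all right-hand sides.\<close>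

definition conformal_kernel_free :: "real ^ 'n ^ 'm \<Rightarrow> (real ^ 'n::finite) set"
  where "conformal_kernel_free A = {d. \<forall>k. A *v k = 0 \<and> conformal k d \<longrightarrow> k = 0}"

lemma conformal_scaleR_right:
  assumes "c > 0"
  shows "conformal k (c *\<^sub>R d) \<longleftrightarrow> conformal k d"
proof -
  have "0 < k $ j * (c *\<^sub>R d) $ j \<longleftrightarrow> 0 < k $ j * d $ j" for j
    using assms by (auto simp: zero_less_mult_iff mult_less_0_iff)
  then show ?thesis
    unfolding conformal_def by blast
qed

lemma inner_conformal_pos:
  fixes k d :: "real ^ 'n::finite"
  assumes "conformal k d" "k \<noteq> 0"
  shows "0 < d \<bullet> k"
proof -
  obtain j where j: "k $ j \<noteq> 0"
    using assms(2) by (auto simp: vec_eq_iff)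
  have "0 \<le> d $ i * k $ i" for i
    using assms(1) by (cases "k $ i = 0") (auto simp: conformal_def mult.commute less_imp_le)
  moreover have "0 < d $ j * k $ j"
    using assms(1) j by (auto simp: conformal_def mult.commute)
  ultimately show ?thesis
    unfolding inner_vec_def by (intro sum_pos2[of _ j]) auto
qed

lemma open_conformal: "open {d :: real ^ 'n::finite. conformal k d}"
  unfolding conformal_def Collect_all_eq imp_conv_disj
  by (intro open_INT ballI open_Collect_disj open_Collect_const open_Collect_less continuous_intros) auto

text \<open>By homogeneity only unit vectors matter. There the minimum of
  \<open>norm (A *v u)\<close> over a compact set serves as \<open>c\<close>, once \<open>A\<close>
  is known to have no zero on that set.\<close>

lemma conformal_kernel_free_bound:
  fixes A :: "real ^ 'n::finite ^ 'm::finite"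
  obtains c where "c > 0"
    and "\<And>d. d \<in> conformal_kernel_free A \<Longrightarrow> c * norm d \<le> norm (A *v d)"
proof -
  define D where "D = conformal_kernel_free A \<inter> sphere 0 1"
  have D_sphere: "closure D \<subseteq> sphere 0 1"
    unfolding D_def by (intro closure_minimal) auto
  have nonzero: "A *v u \<noteq> 0" if u: "u \<in> closure D" for u
  proof
    assume "A *v u = 0"
    \<comment> \<open>Openness carries conformality of \<open>u\<close> with itself over to some
      \<open>v\<close> in \<open>D\<close> near \<open>u\<close>. Then \<open>u\<close> is a kernel
      vector of the kind excluded for \<open>v\<close>.\<close>
    have "conformal u u"
      by (auto simp: conformal_def zero_less_mult_iff)
    then obtain v where "v \<in> D" "conformal u v"
      using u open_conformal[of u] unfolding closure_iff_nhds_not_empty by blast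
    then have "u = 0"
      using \<open>A *v u = 0\<close> by (auto simp: D_def conformal_kernel_free_def)
    then show False
      using u D_sphere by auto
  qed
  have "compact (closure D)"
    using D_sphere compact_sphere by (meson bounded_subset closed_closure compact_eq_bounded_closed)
  have "\<exists>c>0. \<forall>u\<in>D. c \<le> norm (A *v u)"
  \<comment> \<open>\<open>D\<close> can be empty, for instance when \<open>A = 0\<close>; any
    positive constant then works.\<close>
  proof (cases "D = {}")
    case False
    have "continuous_on (closure D) (\<lambda>u. norm (A *v u))"
      by (intro continuous_intros)
    then obtain w where "w \<in> closure D" "\<And>u. u \<in> closure D \<Longrightarrow> norm (A *v w) \<le> norm (A *v u)"
      using continuous_attains_inf[OF \<open>compact (closure D)\<close>, of "\<lambda>u. norm (A *v u)"] False
      by auto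
    then show ?thesis
      using nonzero closure_subset by (intro exI[of _ "norm (A *v w)"]) auto
  qed (auto intro: zero_less_one)
  then obtain c where "c > 0" and c: "\<And>u. u \<in> D \<Longrightarrow> c \<le> norm (A *v u)"
    by blast
  have "c * norm d \<le> norm (A *v d)" if d: "d \<in> conformal_kernel_free A" for d
  proof (cases "d = 0")
    case False
    then have "inverse (norm d) *\<^sub>R d \<in> D"
      using d by (simp add: D_def conformal_kernel_free_def conformal_scaleR_right)
    from c[OF this] False show ?thesis
      by (simp add: matrix_vector_mult_scaleR field_simps)
  qed simp
  with \<open>c > 0\<close> show thesis
    using that by blast
qed

text \<open>A conformal kernel vector \<open>k\<close> would let \<open>y\<close> slide to
  \<open>y - t *\<^sub>R k\<close> for small \<open>t > 0\<close>, keeping \<open>A *v y\<close> and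
  nonnegativity while coming strictly closer to \<open>x\<close>.\<close>

lemma nearest_point_conformal_kernel_free:
  fixes A :: "real ^ 'n::finite ^ 'm::finite" and x y :: "real ^ 'n"
  assumes x: "\<And>j. 0 \<le> x $ j" and y: "\<And>j. 0 \<le> y $ j"
    and nearest: "\<And>z. (\<And>j. 0 \<le> z $ j) \<Longrightarrow> A *v z = A *v y \<Longrightarrow> dist x y \<le> dist x z"
  shows "y - x \<in> conformal_kernel_free A"
proof -
  have False if Ak: "A *v k = 0" and k: "conformal k (y - x)" and "k \<noteq> 0" for k
  proof -
    \<comment> \<open>Only coordinates with \<open>k $ j > 0\<close> decrease, and there
      conformality gives \<open>y $ j > x $ j \<ge> 0\<close>, which leaves room for a small
      step.\<close>
    have "\<forall>\<^sub>F t in at_right 0. t * k $ j \<le> y $ j" for j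
    proof (cases "k $ j > 0")
      case True
      then have "0 < k $ j * (y - x) $ j"
        using k unfolding conformal_def by (metis less_irrefl)
      with True x[of j] have "0 < y $ j"
        by (simp add: zero_less_mult_iff)
      moreover have "((\<lambda>t. t * k $ j) \<longlongrightarrow> 0 * k $ j) (at_right 0)"
        by (intro tendsto_intros)
      ultimately have "\<forall>\<^sub>F t in at_right 0. t * k $ j < y $ j"
        by (intro order_tendstoD(2)) auto
      then show ?thesis
        by (rule eventually_mono) simp
    next
      case False
      show ?thesis
        using eventually_at_right_less[of 0]
      proof (rule eventually_mono)
        fix t :: real assume "0 < t"
        then have "t * k $ j \<le> 0"
          using False by (simp add: mult_nonneg_nonpos)
        then show "t * k $ j \<le> y $ j"
          using y[of j] by linarith
      qed
    qed
    then have "\<forall>\<^sub>F t in at_right 0. \<forall>j. t * k $ j \<le> y $ j"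
      by (rule eventually_all_finite)
    \<comment> \<open>For small \<open>t\<close> the linear decrease of the squared distance,
      \<open>2 * t * ((y - x) \<bullet> k)\<close>, beats the quadratic increase
      \<open>t * t * (k \<bullet> k)\<close>.\<close>
    moreover have "\<forall>\<^sub>F t in at_right 0. t * (k \<bullet> k) < 2 * ((y - x) \<bullet> k)"
    proof (rule order_tendstoD(2))
      show "((\<lambda>t. t * (k \<bullet> k)) \<longlongrightarrow> 0 * (k \<bullet> k)) (at_right 0)"
        by (intro tendsto_intros)
      show "0 * (k \<bullet> k) < 2 * ((y - x) \<bullet> k)"
        using inner_conformal_pos[OF k \<open>k \<noteq> 0\<close>] by simp
    qed
    ultimately have "\<forall>\<^sub>F t in at_right 0. 0 < t \<and> (\<forall>j. t * k $ j \<le> y $ j) \<and>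
        t * (k \<bullet> k) < 2 * ((y - x) \<bullet> k)"
      using eventually_at_right_less[of 0] by eventually_elim simp
    then obtain t :: real where t: "0 < t" "\<And>j. t * k $ j \<le> y $ j"
        "t * (k \<bullet> k) < 2 * ((y - x) \<bullet> k)"
      using eventually_happens'[OF trivial_limit_at_right_real] by blast
    have "dist x y \<le> dist x (y - t *\<^sub>R k)"
      by (rule nearest)
        (use t(2) Ak in \<open>auto simp: matrix_vector_mult_diff_distrib matrix_vector_mult_scaleR\<close>)
    moreover have "(y - t *\<^sub>R k) - x = (y - x) - t *\<^sub>R k"
      by (simp add: algebra_simps)
    ultimately have "norm (y - x) \<le> norm ((y - x) - t *\<^sub>R k)"
      by (metis dist_commute dist_norm)
    then have "(y - x) \<bullet> (y - x) \<le> ((y - x) - t *\<^sub>R k) \<bullet> ((y - x) - t *\<^sub>R k)"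
      by (simp add: norm_le)
    also have "\<dots> = (y - x) \<bullet> (y - x) - t * (2 * ((y - x) \<bullet> k) - t * (k \<bullet> k))"
      by (simp add: inner_diff_left inner_diff_right inner_commute algebra_simps)
    finally have "t * (2 * ((y - x) \<bullet> k) - t * (k \<bullet> k)) \<le> 0"
      by simp
    with t(1,3) show False
      by (simp add: mult_le_0_iff)
  qed
  then show ?thesis
    by (auto simp: conformal_kernel_free_def)
qed

text \<open>The witness is the point nearest to \<open>x\<close> in the polyhedron with right-hand
  side \<open>A *v y\<close>. The vector \<open>y\<close> certifies that this polyhedron is
  nonempty, and \<open>L\<close> is the inverse of the constant \<open>c\<close> above.\<close>

lemma hoffman_bound:
  fixes A :: "real ^ 'n::finite ^ 'm::finite"
  obtains L where "L \<ge> 0"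
    and "\<And>x y. (\<And>j. 0 \<le> x $ j) \<Longrightarrow> (\<And>j. 0 \<le> y $ j) \<Longrightarrow>
      \<exists>z. (\<forall>j. 0 \<le> z $ j) \<and> A *v z = A *v y \<and> norm (z - x) \<le> L * norm (A *v y - A *v x)"
proof -
  obtain c where "c > 0"
    and c: "\<And>d. d \<in> conformal_kernel_free A \<Longrightarrow> c * norm d \<le> norm (A *v d)"
    using conformal_kernel_free_bound[of A] by blast
  have "\<exists>z. (\<forall>j. 0 \<le> z $ j) \<and> A *v z = A *v y \<and>
      norm (z - x) \<le> inverse c * norm (A *v y - A *v x)"
    if x: "\<And>j. 0 \<le> x $ j" and y: "\<And>j. 0 \<le> y $ j" for x y
  proof -
    let ?P = "{z. (\<forall>j. 0 \<le> z $ j) \<and> A *v z = A *v y}"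
    have "closed ?P"
      by (intro closed_Collect_conj closed_Collect_all closed_Collect_le closed_Collect_eq
          continuous_intros)
    moreover have "?P \<noteq> {}"
      using y by auto
    ultimately obtain z where z: "z \<in> ?P" "\<And>w. w \<in> ?P \<Longrightarrow> dist x z \<le> dist x w"
      using distance_attains_inf[of ?P x] by blast
    have "z - x \<in> conformal_kernel_free A"
      by (rule nearest_point_conformal_kernel_free) (use x z in auto)
    from c[OF this] have "c * norm (z - x) \<le> norm (A *v y - A *v x)"
      using z(1) by (simp add: matrix_vector_mult_diff_distrib)
    then have "norm (z - x) \<le> inverse c * norm (A *v y - A *v x)"
      using \<open>c > 0\<close> by (simp add: field_simps)
    with z(1) show ?thesis
      by blast
  qed
  moreover have "inverse c \<ge> 0"
    using \<open>c > 0\<close> by simp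
  ultimately show thesis
    using that by blast
qed

theorem proposition7:
  fixes X :: "('m::finite, 'n::finite) lp set"
    and A :: "real ^ 'n ^ 'm"
    and p :: "real ^ 'n"
  assumes "lp_domain X"
    and "\<And>\<xi>. \<xi> \<in> X \<Longrightarrow> lp_A \<xi> = A"
    and "\<And>\<xi>. \<xi> \<in> X \<Longrightarrow> lp_p \<xi> = p"
  shows "continuous_on X optimal_value"
proof -
  obtain L where "L \<ge> 0"
    and L: "\<And>x y. (\<And>j. 0 \<le> x $ j) \<Longrightarrow> (\<And>j. 0 \<le> y $ j) \<Longrightarrow>
      \<exists>z. (\<forall>j. 0 \<le> z $ j) \<and> A *v z = A *v y \<and> norm (z - x) \<le> L * norm (A *v y - A *v x)"
    using hoffman_bound[of A] by blast
  \<comment> \<open>A one-sided estimate suffices, since exchanging the two problems bounds the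
    absolute difference.\<close>
  have le: "optimal_value \<xi> - optimal_value \<eta> \<le> norm p * L * dist \<xi> \<eta>"
    if "\<xi> \<in> X" "\<eta> \<in> X" for \<xi> \<eta>
  proof -
    have "optimal_set \<xi> \<noteq> {}" "optimal_set \<eta> \<noteq> {}"
      using assms(1) that by (simp_all add: lp_domain_def)
    then obtain x y where x: "x \<in> optimal_set \<xi>" and y: "y \<in> optimal_set \<eta>"
      by (meson ex_in_conv)
    have fx: "\<And>j. 0 \<le> x $ j" "A *v x = lp_b \<xi>" and fy: "\<And>j. 0 \<le> y $ j" "A *v y = lp_b \<eta>"
      using x y assms(2) that by (auto simp: optimal_set_def feasible_set_def)
    \<comment> \<open>The optimum \<open>x\<close> of the first problem is moved to a point
      \<open>z\<close> feasible for the second. There \<open>z\<close> cannot beat \<open>y\<close>,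
      so the values differ by at most \<open>p \<bullet> (x - z)\<close>.\<close>
    obtain z where z: "\<And>j. 0 \<le> z $ j" "A *v z = lp_b \<eta>"
        "norm (z - x) \<le> L * norm (lp_b \<eta> - lp_b \<xi>)"
      using L[OF fx(1) fy(1)] fx(2) fy(2) by auto
    have "p \<bullet> z \<le> p \<bullet> y"
      using y z assms(2,3) that by (auto simp: optimal_set_def feasible_set_def)
    then have "optimal_value \<xi> - optimal_value \<eta> \<le> p \<bullet> (x - z)"
      using optimal_value_eq[OF x] optimal_value_eq[OF y] assms(3) that
      by (simp add: inner_diff_right)
    also have "\<dots> \<le> norm p * norm (z - x)"
      using norm_cauchy_schwarz[of p "x - z"] by (simp add: norm_minus_commute)
    also have "\<dots> \<le> norm p * (L * norm (lp_b \<eta> - lp_b \<xi>))"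
      using z(3) by (intro mult_left_mono) auto
    \<comment> \<open>\<open>lp_b\<close> is a composition of two projections, neither of which
      increases distances.\<close>
    also have "norm (lp_b \<eta> - lp_b \<xi>) \<le> dist \<xi> \<eta>"
      using order_trans[OF dist_snd_le[of "snd \<xi>" "snd \<eta>"] dist_snd_le[of \<xi> \<eta>]]
      by (simp add: lp_b_def dist_norm[symmetric] dist_commute)
    finally show ?thesis
      using \<open>L \<ge> 0\<close> by (simp add: mult.assoc mult_left_mono)
  qed
  have "(norm p * L)-lipschitz_on X optimal_value"
  proof (rule lipschitz_onI)
    fix \<xi> \<eta> assume "\<xi> \<in> X" "\<eta> \<in> X"
    then show "dist (optimal_value \<xi>) (optimal_value \<eta>) \<le> norm p * L * dist \<xi> \<eta>"
      using le[of \<xi> \<eta>] le[of \<eta> \<xi>] by (simp add: dist_real_def abs_le_iff dist_commute)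
  qed (use \<open>L \<ge> 0\<close> in simp)
  then show ?thesis
    by (rule lipschitz_on_continuous_on)
qed

end
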